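(* Let $a$ and $b$ be positive integers, not both equal to $1$. Then \[\mathcal{A}(a,b) = \big[\mathcal{F}_a(x-1) \bigcirc \mathcal{F}_b(x)\big] + \big[\mathcal{F}_a(x) \bigcirc \mathcal{F}_b(x-1)\big],\] while $\mathcal{A}(1,1) = 1$.
   Context: $\mathcal{A}(a,b)$ is the number of ordered pairs $(S', S'')$ of sets of nonnegative integers with $|S'| = a$, $|S''| = b$, $S', S'' \subseteq \{0,1,\ldots,ab\}$, and $\{y - x \mid x \in S',\ y \in S''\} = \{1,2,\ldots,ab\}$ (equivalently, the number of essentially distinct $\alpha$-graceful labelings of $K_{a,b}$). For a real polynomial $P$ of degree $d$, the numbers $\mathcal{C}(0,P),\ldots,\mathcal{C}(d,P)$ are the unique reals with $P(x) = \sum_{i=0}^d \mathcal{C}(i,P)\binom{x}{i}$, and $\mathcal{C}(k,P) = 0$ for $k > d$. For real polynomials $P, Q$, define $P \bigcirc Q = \sum_{i \ge 0} \mathcal{C}(i,P)\mathcal{C}(i,Q)$. For a positive integer $a$ with prime factorisation $a = p_1^{a_1}\cdots p_r^{a_r}$, define the polynomial $\mathcal{F}_a(x) = \prod_{i=1}^r \binom{x+a_i}{a_i}$ (so $\mathcal{F}_1 = 1$). *)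

theory Defs
  imports "HOL-Computational_Algebra.Computational_Algebra"
begin

text \<open>
  Differences are taken in the integers: truncated subtraction of naturals would silently
  identify all negative differences with 0.
\<close>

definition alpha_labeling_count :: "nat \<Rightarrow> nat \<Rightarrow> nat" where
  "alpha_labeling_count a b = card {(S', S'').
     S' \<subseteq> {0..a * b} \<and> S'' \<subseteq> {0..a * b} \<and> card S' = a \<and> card S'' = b \<and>
     {int y - int x | x y. x \<in> S' \<and> y \<in> S''} = {1..int (a * b)}}"

text \<open>
  The coefficients of a polynomial in the basis of binomial coefficients. The definite
  description is justified by the lemma \<open>binomial_expansion_ex1\<close> below.
\<close>

definition is_binomial_expansion :: "real poly \<Rightarrow> (nat \<Rightarrow> real) \<Rightarrow> bool" where
  "is_binomial_expansion P c \<longleftrightarrow>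
     (\<forall>x. poly P x = (\<Sum>i\<le>degree P. c i * (x gchoose i))) \<and> (\<forall>k>degree P. c k = 0)"

definition binomial_coeff :: "nat \<Rightarrow> real poly \<Rightarrow> real" where
  "binomial_coeff k P = (THE c. is_binomial_expansion P c) k"

text \<open>The series has only finitely many nonzero terms, see \<open>newton_circ_eq_finite_sum\<close>.\<close>

definition newton_circ :: "real poly \<Rightarrow> real poly \<Rightarrow> real" (infixl "\<bigcirc>" 70) where
  "P \<bigcirc> Q = (\<Sum>i. binomial_coeff i P * binomial_coeff i Q)"

text \<open>
  The polynomial version of \<open>gchoose\<close>, which is not available in polynomial rings:
  \<open>binomial_poly p k\<close> has values \<open>poly p x gchoose k\<close>, see \<open>poly_binomial_poly\<close>.
\<close>

definition binomial_poly :: "real poly \<Rightarrow> nat \<Rightarrow> real poly" where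
  "binomial_poly p k = smult (1 / fact k) (\<Prod>i<k. p - of_nat i)"

definition factorisation_poly :: "nat \<Rightarrow> real poly" where
  "factorisation_poly n = (\<Prod>p\<in>prime_factors n. binomial_poly [:real (multiplicity p n), 1:] (multiplicity p n))"

definition shift_poly :: "real poly \<Rightarrow> real poly" where
  "shift_poly P = pcompose P [:-1, 1:]"

lemma poly_shift_poly [simp]: "poly (shift_poly P) x = poly P (x - 1)"
  by (simp add: shift_poly_def poly_pcompose)

lemma poly_binomial_poly: "poly (binomial_poly p k) x = poly p x gchoose k"
  by (simp add: binomial_poly_def gbinomial_prod_rev poly_prod atLeast0LessThan of_nat_poly)

lemma poly_factorisation_poly:
  "poly (factorisation_poly n) x =
     (\<Prod>p\<in>prime_factors n. (x + real (multiplicity p n)) gchoose multiplicity p n)"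
  by (simp add: factorisation_poly_def poly_prod poly_binomial_poly add.commute)

lemma factorisation_poly_1: "factorisation_poly 1 = 1"
  by (simp add: factorisation_poly_def)

lemma degree_binomial_poly_X: "degree (binomial_poly [:0, 1:] k) = k"
proof -
  have "degree (\<Prod>i<k. [:0, 1::real:] - of_nat i) = (\<Sum>i<k. degree ([:0, 1::real:] - of_nat i))"
    by (rule degree_prod_eq_sum_degree) (auto simp: of_nat_poly)
  then show ?thesis
    by (simp add: binomial_poly_def of_nat_poly)
qed

lemma binomial_expansion_exists:
  "degree P \<le> n \<Longrightarrow> \<exists>c. \<forall>x::real. poly P x = (\<Sum>i\<le>n. c i * (x gchoose i))"
proof (induction n arbitrary: P)
  case 0
  then obtain a where "P = [:a:]"
    using degree_eq_zeroE[of P] by auto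
  then show ?case
    by (intro exI[of _ "\<lambda>_. a"]) simp
next
  case (Suc n)
  define B where "B = binomial_poly [:0, 1:] (Suc n)"
  have dB: "degree B = Suc n"
    unfolding B_def by (rule degree_binomial_poly_X)
  then have nz: "coeff B (Suc n) \<noteq> 0"
    using leading_coeff_0_iff[of B] by auto
  define t where "t = coeff P (Suc n) / coeff B (Suc n)"
  have "degree (P - smult t B) \<le> Suc n"
    using Suc.prems dB by (intro degree_diff_le) (auto intro: order.trans[OF degree_smult_le])
  moreover have "coeff (P - smult t B) (Suc n) = 0"
    using nz by (simp add: t_def)
  ultimately have "degree (P - smult t B) \<le> n"
    using leading_coeff_0_iff[of "P - smult t B"] by (cases "degree (P - smult t B) = Suc n") auto
  from Suc.IH[OF this] obtain c where
    c: "\<And>x. poly (P - smult t B) x = (\<Sum>i\<le>n. c i * (x gchoose i))" by blast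
  have "poly P x = (\<Sum>i\<le>Suc n. (c(Suc n := t)) i * (x gchoose i))" for x
    using c[of x] by (simp add: B_def poly_binomial_poly)
  then show ?case by blast
qed

lemma binomial_expansion_unique:
  assumes "\<And>x::real. (\<Sum>i\<le>n. c i * (x gchoose i)) = (\<Sum>i\<le>n. d i * (x gchoose i))" and "k \<le> n"
  shows "c k = (d k :: real)"
  using assms(2)
proof (induction k rule: less_induct)
  case (less k)
  have *: "(\<Sum>i\<le>n. f i * (real k gchoose i)) = (\<Sum>i<k. f i * (real k gchoose i)) + f k" for f
  proof -
    have "(\<Sum>i\<le>n. f i * (real k gchoose i)) = (\<Sum>i\<le>k. f i * (real k gchoose i))"
      using less.prems by (intro sum.mono_neutral_right) (auto simp flip: binomial_gbinomial)
    also have "\<dots> = (\<Sum>i<k. f i * (real k gchoose i)) + f k"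
      by (simp add: lessThan_Suc_atMost[symmetric] binomial_gbinomial[symmetric])
    finally show ?thesis .
  qed
  have "(\<Sum>i<k. c i * (real k gchoose i)) = (\<Sum>i<k. d i * (real k gchoose i))"
    using less by (intro sum.cong) auto
  then show ?case
    using assms(1)[of "real k"] by (simp add: *)
qed

lemma binomial_expansion_ex1: "\<exists>!c. is_binomial_expansion P c"
proof -
  obtain c where c: "\<And>x. poly P x = (\<Sum>i\<le>degree P. c i * (x gchoose i))"
    using binomial_expansion_exists[of P "degree P"] by blast
  show ?thesis
  proof (rule ex1I)
    show "is_binomial_expansion P (\<lambda>i. if i \<le> degree P then c i else 0)"
      by (simp add: is_binomial_expansion_def c)
  next
    fix d assume d: "is_binomial_expansion P d"
    show "d = (\<lambda>i. if i \<le> degree P then c i else 0)"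
    proof
      fix k
      show "d k = (if k \<le> degree P then c k else 0)"
        using d binomial_expansion_unique[of d "degree P" c k] c
        by (auto simp: is_binomial_expansion_def)
    qed
  qed
qed

lemma is_binomial_expansion_binomial_coeff:
  "is_binomial_expansion P (\<lambda>k. binomial_coeff k P)"
  unfolding binomial_coeff_def by (rule theI'[OF binomial_expansion_ex1])

lemma binomial_coeff_eqI: "is_binomial_expansion P c \<Longrightarrow> binomial_coeff k P = c k"
  unfolding binomial_coeff_def using the1_equality[OF binomial_expansion_ex1] by simp

lemma newton_circ_eq_finite_sum:
  assumes "min (degree P) (degree Q) \<le> n"
  shows "P \<bigcirc> Q = (\<Sum>i\<le>n. binomial_coeff i P * binomial_coeff i Q)"
  unfolding newton_circ_def
proof (rule suminf_finite)
  fix i assume "i \<notin> {..n}"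
  then have "i > degree P \<or> i > degree Q"
    using assms by auto
  then show "binomial_coeff i P * binomial_coeff i Q = 0"
    using is_binomial_expansion_binomial_coeff[of P] is_binomial_expansion_binomial_coeff[of Q]
    by (auto simp: is_binomial_expansion_def)
qed simp

end

theory Submission
  imports Defs
begin

text \<open>
  Reflecting \<open>S'\<close> at its maximum and translating \<open>S''\<close> turns an \<open>\<alpha>\<close>-labeling into a pair
  \<open>(A, B)\<close> for which every \<open>m < a * b\<close> is uniquely \<open>x + y\<close> with \<open>x \<in> A\<close>, \<open>y \<in> B\<close>. Say \<open>1 \<in> A\<close>,
  and let \<open>k\<close> be the least number not in \<open>A\<close>. By an argument of de Bruijn, \<open>A\<close> is a union of blocks
  \<open>k * q + {..<k}\<close> and \<open>B\<close> consists of multiples of \<open>k\<close>; dividing by \<open>k\<close> gives a smaller pair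
  with \<open>1 \<notin> A\<close>. Iterating, such pairs correspond to interlaced ordered factorisations of \<open>a\<close> and
  \<open>b\<close> into factors greater than 1.

  On the other side, the value of \<open>\<F>\<^sub>n(x - 1)\<close> at a natural number \<open>k\<close> counts the ordered
  factorisations of \<open>n\<close> into \<open>k\<close> positive factors. Choosing the positions of the factors greater
  than 1 shows that the Newton coefficients of \<open>\<F>\<^sub>n(x - 1)\<close> are the numbers \<open>H\<^sub>i(n)\<close> of
  ordered factorisations into \<open>i\<close> factors greater than 1, and those of \<open>\<F>\<^sub>n(x)\<close> are
  \<open>H\<^sub>i(n) + H\<^sub>i\<^sub>+\<^sub>1(n)\<close> by Pascal's rule.
\<close>

subsection \<open>Ordered factorisations and Newton coefficients\<close>

text \<open>Multiplicativity for coprime arguments. For \<open>j = 0\<close> the prime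
  \<open>p\<close> is absent from the left-hand product, which \<open>f 0 = 1\<close>
  compensates.\<close>

lemma prod_prime_factors_prime_power_mult:
  fixes f :: "nat \<Rightarrow> 'a::comm_monoid_mult" and p :: nat
  assumes "prime p" "\<not> p dvd d" "d > 0" "f 0 = 1"
  shows "(\<Prod>q\<in>prime_factors (p ^ j * d). f (multiplicity q (p ^ j * d))) =
         f j * (\<Prod>q\<in>prime_factors d. f (multiplicity q d))"
proof (cases "j = 0")
  case False
  have pf: "prime_factors (p ^ j * d) = insert p (prime_factors d)"
    using assms False
    by (auto simp: prime_factors_dvd prime_dvd_mult_iff prime_dvd_power_iff primes_dvd_imp_eq)
  have p: "multiplicity p (p ^ j * d) = j"
    using assms by (simp add: prime_elem_multiplicity_mult_distrib not_dvd_imp_multiplicity_0)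
  have "multiplicity q (p ^ j * d) = multiplicity q d" if "q \<in> prime_factors d" for q
  proof -
    have "prime q" "q \<noteq> p"
      using that assms by auto
    then have "multiplicity q (p ^ j) = 0"
      using assms(1) by (intro not_dvd_imp_multiplicity_0) (metis prime_dvd_power primes_dvd_imp_eq)
    then show ?thesis
      using \<open>prime q\<close> assms by (simp add: prime_elem_multiplicity_mult_distrib)
  qed
  moreover have "p \<notin> prime_factors d"
    using assms by auto
  ultimately show ?thesis
    by (simp add: pf p)
qed (use assms in auto)

lemma bij_betw_divisors_prime_power_mult:
  fixes p :: nat
  assumes "prime p" "\<not> p dvd m" "m > 0"
  shows "bij_betw (\<lambda>(j, d). p ^ j * d) ({..k} \<times> {d. d dvd m}) {d. d dvd p ^ k * m}"
proof (rule bij_betw_imageI)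
  show "inj_on (\<lambda>(j, d). p ^ j * d) ({..k} \<times> {d. d dvd m})"
  proof (rule inj_onI, clarsimp)
    fix i c j d
    assume *: "c dvd m" "d dvd m" "p ^ i * c = p ^ j * d"
    have "multiplicity p (p ^ i * e) = i" if "e dvd m" for i e
    proof -
      have "\<not> p dvd e" "e \<noteq> 0"
        using that assms dvd_trans[of p e m] by auto
      then show ?thesis
        using assms by (simp add: prime_elem_multiplicity_mult_distrib not_dvd_imp_multiplicity_0)
    qed
    from this[OF *(1), of i] this[OF *(2), of j] have "i = j"
      unfolding *(3) by (rule trans[OF sym])
    moreover have "p ^ i \<noteq> 0"
      using assms(1) by (simp add: prime_gt_0_nat)
    ultimately show "i = j \<and> c = d"
      using *(3) by (metis mult_left_cancel)
  qed
  show "(\<lambda>(j, d). p ^ j * d) ` ({..k} \<times> {d. d dvd m}) = {d. d dvd p ^ k * m}"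
  proof (intro equalityI subsetI)
    fix d assume "d \<in> {d. d dvd p ^ k * m}"
    then obtain b c where bc: "d = b * c" "b dvd p ^ k" "c dvd m"
      using division_decomp[of d "p ^ k" m] by auto
    then obtain j where "j \<le> k" "b = p ^ j"
      by (metis divides_primepow_nat[OF assms(1)])
    then show "d \<in> (\<lambda>(j, d). p ^ j * d) ` ({..k} \<times> {d. d dvd m})"
      using bc(1,3) by (intro image_eqI[of _ _ "(j, c)"]) simp_all
  next
    fix d assume "d \<in> (\<lambda>(j, d). p ^ j * d) ` ({..k} \<times> {d. d dvd m})"
    then obtain j c where "j \<le> k" "c dvd m" "d = p ^ j * c"
      by auto
    then show "d \<in> {d. d dvd p ^ k * m}"
      by (metis le_imp_power_dvd mem_Collect_eq mult_dvd_mono)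
  qed
qed

text \<open>An Euler product: a divisor chooses its exponent at each prime independently. The
  induction strips one full prime power \<open>p ^ k\<close> from \<open>n\<close> at a
  time.\<close>

lemma sum_divisors_prod_prime_factors:
  fixes f :: "nat \<Rightarrow> 'a::comm_semiring_1" and n :: nat
  assumes "f 0 = 1" "n > 0"
  shows "(\<Sum>d | d dvd n. \<Prod>p\<in>prime_factors d. f (multiplicity p d)) =
         (\<Prod>p\<in>prime_factors n. \<Sum>j\<le>multiplicity p n. f j)"
  using \<open>n > 0\<close>
proof (induction n rule: less_induct)
  case (less n)
  show ?case
  proof (cases "n = 1")
    case False
    then obtain p where p: "prime p" "p dvd n"
      using prime_factor_nat by blast
    define k where "k = multiplicity p n"
    obtain m where m: "n = p ^ k * m" "\<not> p dvd m"
      using multiplicity_decompose'[of n p] p less.prems k_def by (metis neq0_conv not_prime_unit)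
    have "k > 0"
      using m p by (intro Nat.gr0I) auto
    then have "m < n" "m > 0"
      using less.prems m(1) p(1) prime_gt_1_nat[of p] one_less_power[of p k] by auto
    have "(\<Sum>d | d dvd n. \<Prod>q\<in>prime_factors d. f (multiplicity q d)) =
          (\<Sum>(j, d)\<in>{..k} \<times> {d. d dvd m}.
             \<Prod>q\<in>prime_factors (p ^ j * d). f (multiplicity q (p ^ j * d)))"
      unfolding m(1) using p(1) m(2) \<open>m > 0\<close>
      by (subst sum.reindex_bij_betw[OF bij_betw_divisors_prime_power_mult, symmetric])
         (auto simp: case_prod_unfold)
    also have "\<dots> = (\<Sum>(j, d)\<in>{..k} \<times> {d. d dvd m}.
             f j * (\<Prod>q\<in>prime_factors d. f (multiplicity q d)))"
    proof (intro sum.cong refl, clarify)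
      fix j d assume "d dvd m"
      then have "\<not> p dvd d" "d > 0"
        using m(2) \<open>m > 0\<close> dvd_trans[of p d m] by (auto intro: Nat.gr0I)
      then show "(\<Prod>q\<in>prime_factors (p ^ j * d). f (multiplicity q (p ^ j * d))) =
                 f j * (\<Prod>q\<in>prime_factors d. f (multiplicity q d))"
        using p(1) assms(1) by (intro prod_prime_factors_prime_power_mult)
    qed
    also have "\<dots> = (\<Sum>j\<le>k. f j) * (\<Sum>d | d dvd m. \<Prod>q\<in>prime_factors d. f (multiplicity q d))"
      by (simp add: sum_product sum.cartesian_product)
    also have "\<dots> = (\<Prod>q\<in>prime_factors n. \<Sum>j\<le>multiplicity q n. f j)"
      using less.IH[OF \<open>m < n\<close> \<open>m > 0\<close>] p(1) m \<open>m > 0\<close> assms(1)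
      by (simp add: prod_prime_factors_prime_power_mult[where f = "\<lambda>i. \<Sum>j\<le>i. f j"])
    finally show ?thesis .
  qed (use assms in auto)
qed

section \<open>Counting ordered factorisations\<close>

text \<open>For positive \<open>n\<close>, \<open>d\<close> is the product of the first
  \<open>i\<close> factors and \<open>n div d > 1\<close> is the last one.\<close>

primrec ordered_factorisations :: "nat \<Rightarrow> nat \<Rightarrow> nat" where
  "ordered_factorisations 0 n = of_bool (n = 1)"
| "ordered_factorisations (Suc i) n = (\<Sum>d | d dvd n \<and> d \<noteq> n. ordered_factorisations i d)"

lemma ordered_factorisations_eq_0:
  "0 < n \<Longrightarrow> n \<le> i \<Longrightarrow> ordered_factorisations i n = 0"
proof (induction i arbitrary: n)
  case (Suc i)
  have "ordered_factorisations i d = 0" if "d dvd n" "d \<noteq> n" for d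
    using that Suc.prems dvd_imp_le[OF that(1)] by (intro Suc.IH) (auto intro: Nat.gr0I)
  then show ?case
    by simp
qed simp

primrec weak_factorisations :: "nat \<Rightarrow> nat \<Rightarrow> nat" where
  "weak_factorisations 0 n = of_bool (n = 1)"
| "weak_factorisations (Suc k) n = (\<Sum>d | d dvd n. weak_factorisations k d)"

text \<open>A factorisation into \<open>k\<close> positive factors is fixed by the \<open>i\<close>
  positions of its factors above 1 and by those factors. The induction separates
  \<open>d = n\<close> (last factor 1) and merges with Pascal's rule.\<close>

lemma weak_factorisations_eq_sum:
  "n > 0 \<Longrightarrow> weak_factorisations k n = (\<Sum>i\<le>k. (k choose i) * ordered_factorisations i n)"
proof (induction k arbitrary: n)
  case (Suc k)
  have "weak_factorisations (Suc k) n =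
        weak_factorisations k n + (\<Sum>d | d dvd n \<and> d \<noteq> n. weak_factorisations k d)"
  proof -
    have "{d. d dvd n} = insert n {d. d dvd n \<and> d \<noteq> n}"
      by auto
    moreover have "finite {d. d dvd n \<and> d \<noteq> n}"
      using Suc.prems by (intro finite_subset[OF _ finite_divisors_nat[of n]]) auto
    ultimately show ?thesis
      by simp
  qed
  also have "(\<Sum>d | d dvd n \<and> d \<noteq> n. weak_factorisations k d) =
             (\<Sum>d | d dvd n \<and> d \<noteq> n. \<Sum>i\<le>k. (k choose i) * ordered_factorisations i d)"
    using Suc.prems by (intro sum.cong refl Suc.IH) (auto intro: Nat.gr0I)
  also have "\<dots> = (\<Sum>i\<le>k. (k choose i) * ordered_factorisations (Suc i) n)"
    by (subst sum.swap) (simp add: sum_distrib_left)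
  \<comment> \<open>The added top term is 0 because \<open>k choose Suc k = 0\<close>; it lets the
    index shift line up the two sums.\<close>
  also have "weak_factorisations k n = (\<Sum>i\<le>Suc k. (k choose i) * ordered_factorisations i n)"
    using Suc by simp
  also have "\<dots> = ordered_factorisations 0 n +
                  (\<Sum>i\<le>k. (k choose Suc i) * ordered_factorisations (Suc i) n)"
    by (subst sum.atMost_Suc_shift) simp
  finally show ?case
    by (subst sum.atMost_Suc_shift)
       (simp add: sum.distrib algebra_simps del: ordered_factorisations.simps)
qed simp

text \<open>Stars and bars: each prime distributes its exponent over the \<open>Suc k\<close>
  factors independently. Inductively, the divisor sum factors over the primes and each factor is a
  hockey-stick sum.\<close>

lemma weak_factorisations_eq_prod:
  "n > 0 \<Longrightarrow> weak_factorisations (Suc k) n =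
     (\<Prod>p\<in>prime_factors n. (k + multiplicity p n) choose multiplicity p n)"
proof (induction k arbitrary: n)
  case 0
  then show ?case
    by (simp add: of_bool_def)
next
  case (Suc k)
  have "weak_factorisations (Suc (Suc k)) n =
        (\<Sum>d | d dvd n. \<Prod>p\<in>prime_factors d. (k + multiplicity p d) choose multiplicity p d)"
    using Suc.prems
    by (subst weak_factorisations.simps, intro sum.cong refl Suc.IH) (auto intro: Nat.gr0I)
  also have "\<dots> = (\<Prod>p\<in>prime_factors n. \<Sum>j\<le>multiplicity p n. (k + j) choose j)"
    using Suc.prems by (subst sum_divisors_prod_prime_factors) auto
  finally show ?case
    by (simp add: sum_choose_lower)
qed

section \<open>Newton coefficients of the factorisation polynomials\<close>

text \<open>At the points 0, ..., k the coefficients satisfy a triangular system with diagonal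
  \<open>k choose k = 1\<close>, so the values determine them one after another.\<close>

lemma binomial_coeff_eqI_nat:
  assumes "\<And>k::nat. poly P (real k) = (\<Sum>i\<le>k. real (k choose i) * h i)"
  shows "binomial_coeff k P = h k"
proof (induction k rule: less_induct)
  case (less k)
  define c where "c i = binomial_coeff i P" for i
  have c: "poly P x = (\<Sum>i\<le>degree P. c i * (x gchoose i))" "i > degree P \<Longrightarrow> c i = 0" for x i
    using is_binomial_expansion_binomial_coeff[of P] by (auto simp: is_binomial_expansion_def c_def)
  have "(\<Sum>i\<le>degree P. c i * (real k gchoose i)) = (\<Sum>i\<le>k. real (k choose i) * c i)"
    using c(2)
    by (intro sum.mono_neutral_cong) (auto simp: not_le simp flip: binomial_gbinomial)
  then have "(\<Sum>i\<le>k. real (k choose i) * c i) = (\<Sum>i\<le>k. real (k choose i) * h i)"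
    using assms[of k] c(1)[of "real k"] by simp
  moreover have "(\<Sum>i<k. real (k choose i) * c i) = (\<Sum>i<k. real (k choose i) * h i)"
    using less.IH by (intro sum.cong) (auto simp: c_def)
  ultimately have "c k = h k"
    by (simp add: lessThan_Suc_atMost[symmetric])
  then show ?case
    by (simp add: c_def)
qed

lemma poly_factorisation_poly_nat:
  assumes "n > 0"
  shows "poly (factorisation_poly n) (real k) = real (weak_factorisations (Suc k) n)"
  unfolding poly_factorisation_poly weak_factorisations_eq_prod[OF assms] of_nat_prod
  by (intro prod.cong refl) (metis binomial_gbinomial of_nat_add)

text \<open>Supplies the value of the shifted polynomial at 0. A prime of multiplicity
  \<open>m > 0\<close> contributes the factor \<open>(m - 1) choose m = 0\<close>.\<close>

lemma poly_factorisation_poly_minus_1: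
  assumes "n > 0"
  shows "poly (factorisation_poly n) (-1) = of_bool (n = 1)"
proof (cases "n = 1")
  case False
  then obtain p where p: "prime p" "p dvd n"
    using prime_factor_nat by blast
  then have m: "p \<in> prime_factors n" "multiplicity p n > 0"
    using assms by (auto simp: prime_factors_multiplicity prime_multiplicity_gt_zero_iff)
  then have "(-1 + real (multiplicity p n)) gchoose multiplicity p n =
             real ((multiplicity p n - 1) choose multiplicity p n)"
    by (simp add: binomial_gbinomial of_nat_diff)
  also have "\<dots> = 0"
    using m by simp
  finally show ?thesis
    unfolding poly_factorisation_poly using m(1) False by (auto intro!: prod_zero)
qed (simp add: factorisation_poly_1[unfolded One_nat_def])

lemma binomial_coeff_shift_factorisation_poly:
  assumes "n > 0"
  shows "binomial_coeff i (shift_poly (factorisation_poly n)) = real (ordered_factorisations i n)"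
proof (rule binomial_coeff_eqI_nat)
  fix k
  have "poly (shift_poly (factorisation_poly n)) (real k) = real (weak_factorisations k n)"
    using assms by (cases k) (simp_all add: poly_factorisation_poly_nat
        poly_factorisation_poly_minus_1 del: weak_factorisations.simps(2))
  then show "poly (shift_poly (factorisation_poly n)) (real k) =
        (\<Sum>i\<le>k. real (k choose i) * real (ordered_factorisations i n))"
    by (simp add: weak_factorisations_eq_sum[OF assms])
qed

lemma binomial_coeff_factorisation_poly:
  assumes "n > 0"
  shows "binomial_coeff i (factorisation_poly n) =
         real (ordered_factorisations i n) + real (ordered_factorisations (Suc i) n)"
proof (rule binomial_coeff_eqI_nat)
  fix k
  have "weak_factorisations (Suc k) n =
        (\<Sum>i\<le>Suc k. (k choose i) * ordered_factorisations i n) +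
        (\<Sum>i\<le>k. (k choose i) * ordered_factorisations (Suc i) n)"
    unfolding weak_factorisations_eq_sum[OF assms]
    by (subst (1 2) sum.atMost_Suc_shift)
       (simp add: sum.distrib algebra_simps del: ordered_factorisations.simps)
  also have "\<dots> = (\<Sum>i\<le>k. (k choose i) * (ordered_factorisations i n + ordered_factorisations (Suc i) n))"
    by (simp add: sum.distrib distrib_left del: ordered_factorisations.simps)
  finally show "poly (factorisation_poly n) (real k) = (\<Sum>i\<le>k. real (k choose i) *
      (real (ordered_factorisations i n) + real (ordered_factorisations (Suc i) n)))"
    unfolding poly_factorisation_poly_nat[OF assms]
    by (simp del: ordered_factorisations.simps weak_factorisations.simps)
qed

subsection \<open>Tilings of an interval by two sets\<close>

definition tiles :: "nat set \<Rightarrow> nat set \<Rightarrow> nat \<Rightarrow> bool" where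
  "tiles A B n \<longleftrightarrow> bij_betw (\<lambda>(x, y). x + y) (A \<times> B) {..<n}"

text \<open>Counting replaces the check of uniqueness: a surjection between finite sets of equal
  size is injective.\<close>

lemma tilesI:
  assumes "finite A" "finite B" "card A * card B = n"
    and "\<And>x y. x \<in> A \<Longrightarrow> y \<in> B \<Longrightarrow> x + y < n"
    and "\<And>m. m < n \<Longrightarrow> \<exists>x\<in>A. \<exists>y\<in>B. m = x + y"
  shows "tiles A B n"
proof -
  have "(\<lambda>(x, y). x + y) ` (A \<times> B) = {..<n}"
    using assms(4,5) by force
  moreover have "inj_on (\<lambda>(x, y). x + y) (A \<times> B)"
    using assms(1-3) calculation by (intro eq_card_imp_inj_on) (auto simp: card_cartesian_product)
  ultimately show ?thesis
    by (simp add: tiles_def bij_betw_def)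
qed

lemma tiles_less: "tiles A B n \<Longrightarrow> x \<in> A \<Longrightarrow> y \<in> B \<Longrightarrow> x + y < n"
  unfolding tiles_def using bij_betw_apply by fastforce

lemma tiles_cover:
  assumes "tiles A B n" "m < n"
  obtains x y where "x \<in> A" "y \<in> B" "m = x + y"
proof -
  have "m \<in> (\<lambda>(x, y). x + y) ` (A \<times> B)"
    using assms by (simp add: tiles_def bij_betw_def)
  then show ?thesis
    using that by auto
qed

lemma tiles_inj:
  assumes "tiles A B n" "x \<in> A" "y \<in> B" "x' \<in> A" "y' \<in> B" "x + y = x' + y'"
  shows "x = x'" "y = y'"
  using assms inj_onD[of "\<lambda>(x, y). x + y" "A \<times> B" "(x, y)" "(x', y')"]
  by (auto simp: tiles_def bij_betw_def)

lemma tiles_0: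
  assumes "tiles A B n" "n > 0"
  shows "0 \<in> A" "0 \<in> B"
  using assms tiles_cover[of A B n 0] by auto

lemma tiles_commute: "tiles A B n \<longleftrightarrow> tiles B A n"
proof -
  have "tiles B A n" if "tiles A B n" for A B
  proof -
    have "bij_betw (\<lambda>(x, y). (y, x)) (B \<times> A) (A \<times> B)"
      by (rule bij_betw_byWitness[where f' = "\<lambda>(x, y). (y, x)"]) auto
    from bij_betw_trans[OF this that[unfolded tiles_def]] show ?thesis
      by (simp add: tiles_def o_def case_prod_unfold add.commute)
  qed
  then show ?thesis
    by blast
qed

text \<open>
  The induction follows de Bruijn: cut the naturals into blocks of length \<open>k\<close> and suppose the
  claim for all blocks before the one starting at \<open>k * q\<close>. If \<open>k * q\<close> is a sum of earlier
  elements, then so is its whole block, which thus avoids \<open>A\<close> and \<open>B\<close>. Otherwise \<open>k * q\<close> lies in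
  \<open>B\<close>, and then \<open>{..<k} + k * q\<close> fills the block, or in \<open>A\<close>, and then \<open>k \<in> B\<close> excludes every
  \<open>k * q + j \<in> B\<close> by \<open>(k * q + j) + (k - j) = k * q + k\<close>.
\<close>
lemma tiles_block_structure:
  assumes t: "tiles A B n" and n: "n > 0" and k: "{..<k} \<subseteq> A" "k \<notin> A" "k > 0"
  shows "m \<in> B \<Longrightarrow> k dvd m" and "m \<in> A \<longleftrightarrow> k * (m div k) \<in> A"
proof -
  note inj = tiles_inj[OF t]
  note zero = tiles_0[OF t n]
  \<comment> \<open>Such a \<open>y\<close> also lies in \<open>A\<close>, so
    \<open>0 + y = y + 0\<close> are two representations of it.\<close>
  have small: "y = 0" if "y \<in> B" "y < k" for y
    using inj(2)[of 0 y y 0] that zero k by auto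
  have "\<forall>m. m div k = q \<longrightarrow> (m \<in> B \<longrightarrow> k dvd m) \<and> (m \<in> A \<longleftrightarrow> k * q \<in> A)" for q
  proof (induction q rule: less_induct)
    case (less q)
    show ?case
    proof (cases "q = 0")
      case True
      then show ?thesis
        using small zero k by (auto simp: div_eq_0_iff)
    next
      case False
      have IHB: "k dvd y" if "y \<in> B" "y < k * q" for y
      proof -
        have "y div k < q"
          using that by (intro less_mult_imp_div_less) (simp add: mult.commute)
        with less.IH that show ?thesis
          by blast
      qed
      have IHA: "x \<in> A \<longleftrightarrow> k * (x div k) \<in> A" if "x < k * q" for x
      proof -
        have "x div k < q"
          using that by (intro less_mult_imp_div_less) (simp add: mult.commute)
        with less.IH show ?thesis
          by blast
      qed
      have block: "(k * q + j \<in> B \<longrightarrow> j = 0) \<and> (k * q + j \<in> A \<longleftrightarrow> k * q \<in> A)" if "j < k" for j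
      proof (cases "\<exists>x y. x \<in> A \<and> y \<in> B \<and> x < k * q \<and> y < k * q \<and> k * q = x + y")
        case True
        then obtain x y where xy: "x \<in> A" "y \<in> B" "x < k * q" "y < k * q" "k * q = x + y"
          by blast
        have "k dvd x"
          using IHB[OF xy(2,4)] xy(5) by (metis dvd_add_left_iff dvd_triv_left)
        \<comment> \<open>By induction \<open>A\<close> contains the whole block of
          \<open>x\<close>, so \<open>k * q + i = (x + i) + y\<close>. Membership of
          \<open>k * q + i\<close> in \<open>A\<close> or \<open>B\<close> would give a second
          representation, with summand 0.\<close>
        have "x + i \<in> A" if "i < k" for i
        proof -
          have "(x + i) div k = x div k"
            using that \<open>k dvd x\<close> by (auto elim!: dvdE)
          moreover have "x + i < k * q"
          proof -
            obtain x' where "x = k * x'"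
              using \<open>k dvd x\<close> by blast
            with xy(3) have "x + k \<le> k * q"
              using k by (metis Suc_leI add.commute mult_Suc_right mult_le_mono2 nat_mult_less_cancel_disj)
            with that show ?thesis
              by simp
          qed
          ultimately show ?thesis
            using IHA[of "x + i"] IHA[of x] xy by simp
        qed
        then have *: "x + i \<in> A" "k * q + i = (x + i) + y" if "i < k" for i
          using that xy by auto
        have "k * q + i \<notin> A" if "i < k" for i
          using inj(1)[of "k * q + i" 0 "x + i" y] *[OF that] xy zero by auto
        moreover have "k * q + i \<notin> B" if "i < k" for i
          using inj(2)[of 0 "k * q + i" "x + i" y] *[OF that] xy zero by auto
        ultimately show ?thesis
          using that k(3) by (metis add_0_right)
      next
        case no_sum: False
        \<comment> \<open>Since \<open>k * q\<close> is not a sum of two smaller elements, any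
          representation of it has a summand 0.\<close>
        consider "k * q \<ge> n" | "k * q \<in> B" "k * q < n" | "k * q \<in> A" "k * q \<notin> B" "k * q < n"
        proof (cases "k * q < n")
          case True
          then obtain x y where "x \<in> A" "y \<in> B" "k * q = x + y"
            using tiles_cover[OF t] by blast
          then show ?thesis
            using that no_sum True
            by (metis add_0_left add_0_right le_add1 le_add2 le_neq_implies_less add_left_cancel
                add_right_cancel)
        qed (use that in auto)
        then show ?thesis
        proof cases
          case 1
          have "x < n" if "x \<in> A \<union> B" for x
            using that tiles_less[OF t, of x 0] tiles_less[OF t, of 0 x] zero by auto
          with 1 show ?thesis
            by (metis UnCI add_lessD1 not_less)
        next
          case 2
          have "k * q + i \<notin> A" if "i < k" for i
            using inj(2)[of "k * q + i" 0 i "k * q"] that 2 k False zero by auto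
          moreover have "i = 0" if "i < k" "k * q + i \<in> B" for i
            using inj(1)[of 0 "k * q + i" i "k * q"] that 2 k zero by auto
          ultimately show ?thesis
            using that k(3) by (metis add_0_right)
        next
          case 3
          have "k \<le> k * q"
            using False by simp
          with 3(3) have "k < n"
            by linarith
          then obtain x y where xy: "x \<in> A" "y \<in> B" "k = x + y"
            using tiles_cover[OF t] by blast
          \<comment> \<open>In \<open>k = x + y\<close> the summand \<open>y\<close> is 0 or at
            least \<open>k\<close>; as \<open>k\<close> is not in \<open>A\<close>, it must be
            \<open>k\<close>.\<close>
          have "k \<in> B"
            using xy small[of y] k by (metis add_0_left add_0_right le_add2 le_neq_implies_less)
          have B: "i = 0" if "i < k" "k * q + i \<in> B" for i
          proof (rule ccontr)
            assume "i \<noteq> 0"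
            then have "k - i \<in> A" "(k - i) + (k * q + i) = k * q + k"
              using that k by auto
            from inj(2)[OF this(1) that(2) 3(1) \<open>k \<in> B\<close> this(2)] \<open>k \<le> k * q\<close> \<open>i \<noteq> 0\<close>
            show False
              by simp
          qed
          \<comment> \<open>Otherwise \<open>k * q + j = x + y\<close> with both summands below
            \<open>k * q\<close>. Then \<open>k\<close> divides \<open>y\<close>, and rounding
            \<open>x\<close> down to a multiple of \<open>k\<close> stays in \<open>A\<close> and
            gives a second representation of \<open>k * q + 0\<close>.\<close>
          have "k * q + j \<in> A"
          proof (rule ccontr)
            assume nA: "k * q + j \<notin> A"
            have "k * q + j < n"
              using tiles_less[OF t 3(1) \<open>k \<in> B\<close>] that by simp
            then obtain x y where xy: "x \<in> A" "y \<in> B" "k * q + j = x + y"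
              using tiles_cover[OF t] by blast
            have "y \<noteq> 0"
              using nA xy by (metis add_0_right)
            have "y < k * q"
            proof (rule ccontr)
              assume "\<not> y < k * q"
              then obtain i where "y = k * q + i"
                using le_Suc_ex not_less by blast
              with xy that have "i < k"
                by simp
              with B[of i] xy \<open>y = k * q + i\<close> 3(2) show False
                by auto
            qed
            have "x < k * q"
            proof (rule ccontr)
              assume "\<not> x < k * q"
              with xy that have "y < k"
                by simp
              with small[OF xy(2)] \<open>y \<noteq> 0\<close> show False
                by simp
            qed
            obtain y' where y': "y = k * y'"
              using IHB[OF xy(2) \<open>y < k * q\<close>] by blast
            have "(x + y) div k = q"
              using that by (simp flip: xy(3))
            then have "x div k + y' = q"
              using y' k by simp
            then have "k * (x div k) + y = k * q + 0"
              using y' by (metis add_0_right distrib_left)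
            moreover have "k * (x div k) \<in> A"
              using IHA[OF \<open>x < k * q\<close>] xy by simp
            ultimately show False
              using inj(2)[OF _ xy(2) 3(1) zero(2)] \<open>y \<noteq> 0\<close> by blast
          qed
          with B[OF that] 3(1) show ?thesis
            by blast
        qed
      qed
      show ?thesis
      proof (intro allI impI)
        fix m assume "m div k = q"
        then have "m = k * q + m mod k"
          by (metis mult_div_mod_eq)
        moreover have "m mod k < k"
          using k by simp
        ultimately show "(m \<in> B \<longrightarrow> k dvd m) \<and> (m \<in> A \<longleftrightarrow> k * q \<in> A)"
          using block[of "m mod k"] by (metis mod_0_imp_dvd)
      qed
    qed
  qed
  then show "m \<in> B \<Longrightarrow> k dvd m" and "m \<in> A \<longleftrightarrow> k * (m div k) \<in> A"
    by blast+
qed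

section \<open>Inflation and the recursion for the number of tilings\<close>

definition tilings :: "nat \<Rightarrow> nat \<Rightarrow> (nat set \<times> nat set) set" where
  "tilings a b = {(A, B). tiles A B (a * b) \<and> card A = a \<and> card B = b}"

definition tilings0 :: "nat \<Rightarrow> nat \<Rightarrow> (nat set \<times> nat set) set" where
  "tilings0 a b = {(A, B) \<in> tilings a b. 1 \<notin> A}"

text \<open>The inverse of de Bruijn's division by \<open>k\<close>: each element \<open>q\<close>
  of \<open>A\<close> becomes the block of \<open>k\<close> numbers starting at
  \<open>k * q\<close>.\<close>

definition inflate :: "nat \<Rightarrow> nat set \<times> nat set \<Rightarrow> nat set \<times> nat set" where
  "inflate k = (\<lambda>(A, B). ({m. m div k \<in> A}, (*) k ` B))"

lemma tiles_subset:
  assumes "tiles A B n" "n > 0"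
  shows "A \<subseteq> {..<n}" "B \<subseteq> {..<n}"
  using tiles_less[OF assms(1) _ tiles_0(2)[OF assms]] tiles_less[OF assms(1) tiles_0(1)[OF assms]]
  by auto

lemma finite_tilings:
  assumes "a > 0" "b > 0"
  shows "finite (tilings a b)"
proof (rule finite_subset)
  show "tilings a b \<subseteq> Pow {..<a * b} \<times> Pow {..<a * b}"
    using tiles_subset[of _ _ "a * b"] assms by (fastforce simp: tilings_def)
qed simp

lemma finite_tilings0:
  assumes "a > 0" "b > 0"
  shows "finite (tilings0 a b)"
  by (rule finite_subset[OF _ finite_tilings[OF assms]]) (auto simp: tilings0_def)

lemma tilings_swap: "(A, B) \<in> tilings a b \<longleftrightarrow> (B, A) \<in> tilings b a"
  by (auto simp: tilings_def tiles_commute[of A B] mult.commute)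

lemma one_in_tilings_iff:
  assumes "(A, B) \<in> tilings a b" "a * b > 1"
  shows "1 \<in> A \<longleftrightarrow> 1 \<notin> B"
proof -
  have t: "tiles A B (a * b)"
    using assms(1) by (simp add: tilings_def)
  have zero: "0 \<in> A" "0 \<in> B"
    using tiles_0[OF t] order.strict_trans[OF zero_less_one assms(2)] by auto
  obtain x y where "x \<in> A" "y \<in> B" "1 = x + y"
    using tiles_cover[OF t assms(2)] .
  then have "1 \<in> A \<or> 1 \<in> B"
    by (cases x) auto
  moreover have "\<not> (1 \<in> A \<and> 1 \<in> B)"
    using tiles_inj(1)[OF t, of 1 0 0 1] zero by auto
  ultimately show ?thesis
    by blast
qed

lemma tilings_one_in_fst:
  assumes "a * b > 1"
  shows "{(A, B) \<in> tilings a b. 1 \<in> A} = prod.swap ` tilings0 b a"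
proof -
  have "(A, B) \<in> prod.swap ` tilings0 b a \<longleftrightarrow> (B, A) \<in> tilings0 b a" for A B
    by force
  then show ?thesis
    using one_in_tilings_iff[OF _ assms] by (auto simp: tilings0_def tilings_swap)
qed

text \<open>Exactly one of the two sets contains 1. This fails for \<open>a = b = 1\<close>, where
  the only tiling would be counted twice.\<close>

lemma card_tilings:
  assumes "a * b > 1"
  shows "card (tilings a b) = card (tilings0 a b) + card (tilings0 b a)"
proof -
  have pos: "a > 0" "b > 0"
    using assms by (auto intro: Nat.gr0I)
  have "tilings a b = tilings0 a b \<union> {(A, B) \<in> tilings a b. 1 \<in> A}"
    by (auto simp: tilings0_def)
  also have "{(A, B) \<in> tilings a b. 1 \<in> A} = prod.swap ` tilings0 b a"
    by (rule tilings_one_in_fst[OF assms])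
  finally have eq: "tilings a b = tilings0 a b \<union> prod.swap ` tilings0 b a" .
  have "tilings0 a b \<inter> prod.swap ` tilings0 b a = {}"
    unfolding tilings_one_in_fst[OF assms, symmetric] by (auto simp: tilings0_def)
  then show ?thesis
    unfolding eq using pos
    by (subst card_Un_disjoint) (auto simp: finite_tilings0 card_image)
qed

lemma tilings_1_1: "tilings 1 1 = {({0}, {0})}"
proof -
  have "A = {0} \<and> B = {0}" if "(A, B) \<in> tilings 1 1" for A B
    using that tiles_0[of A B 1] by (auto simp: tilings_def card_1_singleton_iff)
  moreover have "tiles {0} {0} 1"
    by (rule tilesI) auto
  ultimately show ?thesis
    by (auto simp: tilings_def)
qed

lemma div_preimage_eq_image:
  fixes k :: nat
  assumes "k > 0"
  shows "{m. m div k \<in> A} = (\<lambda>(q, r). k * q + r) ` (A \<times> {..<k})"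
proof (intro equalityI subsetI)
  fix m assume "m \<in> {m. m div k \<in> A}"
  then show "m \<in> (\<lambda>(q, r). k * q + r) ` (A \<times> {..<k})"
    using assms by (intro image_eqI[of _ _ "(m div k, m mod k)"]) auto
qed (use assms in auto)

lemma
  fixes k :: nat
  assumes "k > 0" "finite A"
  shows finite_div_preimage: "finite {m. m div k \<in> A}"
    and card_div_preimage: "card {m. m div k \<in> A} = k * card A"
proof -
  have "inj_on (\<lambda>(q, r). k * q + r) (A \<times> {..<k})"
  proof (rule inj_onI, clarify)
    fix q r q' r' assume rk: "r < k" "r' < k" and eq: "k * q + r = k * q' + r'"
    from rk have "(k * q + r) div k = q" "(k * q' + r') div k = q'"
      by auto
    with eq have "q = q'"
      by metis
    with eq show "q = q' \<and> r = r'"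
      by simp
  qed
  then show "card {m. m div k \<in> A} = k * card A"
    by (simp add: div_preimage_eq_image[OF assms(1)] card_image card_cartesian_product mult.commute)
  show "finite {m. m div k \<in> A}"
    using assms(2) by (simp add: div_preimage_eq_image[OF assms(1)])
qed

lemma inflate_in_tilings:
  assumes "(A, B) \<in> tilings a b" "a > 0" "b > 0" "k > 0"
  shows "inflate k (A, B) \<in> tilings (k * a) b"
proof -
  have t: "tiles A B (a * b)" and c: "card A = a" "card B = b"
    using assms(1) by (auto simp: tilings_def)
  have fin: "finite A" "finite B"
    using c assms(2,3) by (auto intro: card_ge_0_finite)
  have cB: "card ((*) k ` B) = b"
    using assms(4) c by (subst card_image) (auto intro: inj_onI)
  have "tiles {m. m div k \<in> A} ((*) k ` B) (k * a * b)"
  proof (rule tilesI)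
    show "card {m. m div k \<in> A} * card ((*) k ` B) = k * a * b"
      using fin assms(4) c cB by (simp add: card_div_preimage)
  next
    fix x y assume "x \<in> {m. m div k \<in> A}" "y \<in> (*) k ` B"
    then obtain z where z: "y = k * z" "z \<in> B" "x div k \<in> A"
      by auto
    then have "(x + y) div k < a * b"
      using tiles_less[OF t z(3,2)] assms(4) by simp
    then show "x + y < k * a * b"
      using assms(4) by (simp add: div_less_iff_less_mult mult_ac)
  next
    fix m assume "m < k * a * b"
    then have "m div k < a * b"
      using assms(4) by (simp add: div_less_iff_less_mult mult_ac)
    then obtain x y where xy: "x \<in> A" "y \<in> B" "m div k = x + y"
      using tiles_cover[OF t] by blast
    have "m = (k * x + m mod k) + k * y"
      using xy(3) mult_div_mod_eq[of k m] by (simp add: distrib_left)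
    moreover have "k * x + m mod k \<in> {m. m div k \<in> A}"
      using xy assms(4) by simp
    ultimately show "\<exists>x\<in>{m. m div k \<in> A}. \<exists>y\<in>(*) k ` B. m = x + y"
      using xy(2) by blast
  qed (use fin assms(4) in \<open>auto simp: finite_div_preimage\<close>)
  then show ?thesis
    using fin assms(4) c cB by (simp add: tilings_def inflate_def card_div_preimage)
qed

lemma inj_inflate:
  assumes "k > 0"
  shows "inj (inflate k)"
proof (rule injI, clarify)
  fix A B A' B'
  assume "inflate k (A, B) = inflate k (A', B')"
  then have eq: "{m. m div k \<in> A} = {m. m div k \<in> A'}" "(*) k ` B = (*) k ` B'"
    by (auto simp: inflate_def)
  have "q \<in> A \<longleftrightarrow> q \<in> A'" for q
    using eq(1)[THEN eqset_imp_iff, of "k * q"] assms by simp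
  moreover have "B = B'"
    using eq(2) assms by (subst (asm) inj_image_eq_iff) (auto intro: injI)
  ultimately show "A = A' \<and> B = B'"
    by blast
qed

text \<open>The inflated set misses \<open>k\<close>, since \<open>k div k = 1\<close> is not in
  \<open>A\<close>, whereas for \<open>k < l\<close> it would contain \<open>k\<close>, since
  \<open>k div l = 0\<close>. Applied in both directions, this recovers the inflation
  parameter.\<close>

lemma inflate_parameter_le:
  assumes "inflate k (A, B) = inflate l (A', B')" "k > 0" "1 \<notin> A" "0 \<in> A'"
  shows "l \<le> k"
proof (rule ccontr)
  assume "\<not> l \<le> k"
  have "{m. m div k \<in> A} = {m. m div l \<in> A'}"
    using assms(1) by (simp add: inflate_def)
  from this[THEN eqset_imp_iff, of k] show False
    using assms(2-4) \<open>\<not> l \<le> k\<close> by simp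
qed

lemma inflate_cases:
  assumes "(A, B) \<in> tilings a b" "1 \<in> A" "a > 0" "b > 0"
  obtains k d p where "a = k * d" "k > 1" "p \<in> tilings0 d b" "(A, B) = inflate k p"
proof -
  have t: "tiles A B (a * b)" and c: "card A = a" "card B = b"
    using assms(1) by (auto simp: tilings_def)
  have pos: "a * b > 0"
    using assms(3,4) by simp
  note zero = tiles_0[OF t pos]
  \<comment> \<open>The length of the initial run of \<open>A\<close>; it exists because
    \<open>A\<close> is bounded, and exceeds 1 because 0 and 1 lie in \<open>A\<close>.\<close>
  define k where "k = (LEAST k. k \<notin> A)"
  have "a * b \<notin> A"
    using tiles_subset(1)[OF t pos] by auto
  then have k: "k \<notin> A"
    unfolding k_def by (rule LeastI)
  have less_k: "{..<k} \<subseteq> A"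
    unfolding k_def using not_less_Least by blast
  have "k > 1"
    using k zero(1) assms(2) by (metis One_nat_def less_one nat_neq_iff)
  then have "k > 0"
    by simp
  note block = tiles_block_structure[OF t pos less_k k \<open>k > 0\<close>]
  define A' where "A' = {q. k * q \<in> A}"
  define B' where "B' = {q. k * q \<in> B}"
  have A: "A = {m. m div k \<in> A'}"
    using block(2) by (auto simp: A'_def)
  have B: "B = (*) k ` B'"
    using block(1) by (auto simp: B'_def elim!: dvdE)
  have inj: "inj ((*) k)"
    using \<open>k > 0\<close> by (auto intro: injI)
  have "finite A" "finite B"
    using c assms(3,4) by (auto intro: card_ge_0_finite)
  then have fin: "finite A'" "finite B'"
    using inj by (auto simp: A'_def B'_def intro!: finite_vimageI[of _ "(*) k", unfolded vimage_def])
  have cA: "a = k * card A'"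
    using card_div_preimage[OF \<open>k > 0\<close> fin(1)] c(1) unfolding A[symmetric] by simp
  have cB: "card B' = b"
    using c(2) inj unfolding B by (subst (asm) card_image) (auto intro: inj_on_subset)
  have "tiles A' B' (card A' * b)"
  proof (rule tilesI)
    fix x y assume "x \<in> A'" "y \<in> B'"
    then have "k * x + k * y < a * b"
      using tiles_less[OF t] by (simp add: A'_def B'_def)
    then have "k * (x + y) < k * (card A' * b)"
      unfolding cA by (simp add: distrib_left mult_ac)
    then show "x + y < card A' * b"
      by simp
  next
    fix m assume "m < card A' * b"
    then have "k * m < a * b"
      unfolding cA using \<open>k > 0\<close> by (simp add: mult_ac)
    then obtain x y where xy: "x \<in> A" "y \<in> B" "k * m = x + y"
      using tiles_cover[OF t] by blast
    then obtain y' where y': "y = k * y'" "y' \<in> B'"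
      using B by auto
    with xy(3) have "k dvd x"
      by (metis dvd_add_left_iff dvd_triv_left)
    then obtain x' where x': "x = k * x'"
      by blast
    then have "x' \<in> A'"
      using xy(1) by (simp add: A'_def)
    moreover have "m = x' + y'"
      using xy(3) x' y'(1) \<open>k > 0\<close> by (simp flip: distrib_left)
    ultimately show "\<exists>x\<in>A'. \<exists>y\<in>B'. m = x + y"
      using y'(2) by blast
  qed (use fin cB in auto)
  \<comment> \<open>\<open>k \<notin> A\<close> says precisely that
    \<open>1 \<notin> A'\<close>.\<close>
  then have "(A', B') \<in> tilings0 (card A') b"
    using k cB by (simp add: tilings0_def tilings_def A'_def)
  moreover have "(A, B) = inflate k (A', B')"
    using A B by (simp add: inflate_def)
  ultimately show ?thesis
    using that cA \<open>k > 1\<close> by blast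
qed

text \<open>Each such tiling is an inflation, by a unique \<open>k = a div d > 1\<close>, of a
  unique tiling in \<open>tilings0 d b\<close>.\<close>

lemma card_tilings_one_in_fst:
  assumes "a > 0" "b > 0"
  shows "card {(A, B) \<in> tilings a b. 1 \<in> A} = (\<Sum>d | d dvd a \<and> d \<noteq> a. card (tilings0 d b))"
proof -
  define D where "D = {d. d dvd a \<and> d \<noteq> a}"
  have D: "d > 0" "a div d > 1" "a div d * d = a" if "d \<in> D" for d
    using that assms(1) by (auto simp: D_def elim!: dvdE)
  have zero: "0 \<in> A" if "(A, B) \<in> tilings0 d b" "d > 0" for A B d
    using that assms(2) tiles_0(1)[of A B "d * b"] by (auto simp: tilings0_def tilings_def)
  have "{(A, B) \<in> tilings a b. 1 \<in> A} = (\<Union>d\<in>D. inflate (a div d) ` tilings0 d b)"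
  proof (intro equalityI subsetI; clarify)
    fix A B assume AB: "(A, B) \<in> tilings a b" "1 \<in> A"
    obtain k d p where *: "a = k * d" "k > 1" "p \<in> tilings0 d b" "(A, B) = inflate k p"
      by (rule inflate_cases[OF AB assms])
    then have "d \<in> D" "inflate (a div d) p = (A, B)"
      using assms(1) by (auto simp: D_def)
    with *(3) show "(A, B) \<in> (\<Union>d\<in>D. inflate (a div d) ` tilings0 d b)"
      by (intro UN_I[of d] image_eqI[of _ _ p]) simp_all
  next
    fix A B d A' B' assume *: "d \<in> D" "(A', B') \<in> tilings0 d b" "(A, B) = inflate (a div d) (A', B')"
    have "inflate (a div d) (A', B') \<in> tilings (a div d * d) b"
      using * D[OF *(1)] assms(2) by (intro inflate_in_tilings) (auto simp: tilings0_def)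
    moreover have "1 \<in> A"
      using *(3) zero[OF *(2)] D[OF *(1)] by (simp add: inflate_def)
    ultimately show "(A, B) \<in> tilings a b \<and> 1 \<in> A"
      using *(3) D(3)[OF *(1)] by simp
  qed
  also have "card \<dots> = (\<Sum>d\<in>D. card (inflate (a div d) ` tilings0 d b))"
  proof (rule card_UN_disjoint)
    show "finite D"
      using assms(1) unfolding D_def by (intro finite_subset[OF _ finite_divisors_nat[of a]]) auto
    show "\<forall>d\<in>D. finite (inflate (a div d) ` tilings0 d b)"
      using D(1) assms(2) finite_tilings0 by blast
    show "\<forall>d\<in>D. \<forall>e\<in>D. d \<noteq> e \<longrightarrow>
            inflate (a div d) ` tilings0 d b \<inter> inflate (a div e) ` tilings0 e b = {}"
    proof (intro ballI impI, rule ccontr)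
      fix d e assume de: "d \<in> D" "e \<in> D" "d \<noteq> e"
        and "inflate (a div d) ` tilings0 d b \<inter> inflate (a div e) ` tilings0 e b \<noteq> {}"
      then obtain A B A' B' where *: "(A, B) \<in> tilings0 d b" "(A', B') \<in> tilings0 e b"
        "inflate (a div d) (A, B) = inflate (a div e) (A', B')"
        by (auto simp: disjoint_iff)
      have "0 \<in> A" "0 \<in> A'" "1 \<notin> A" "1 \<notin> A'"
        using zero * D(1) de by (auto simp: tilings0_def)
      then have "a div d = a div e"
        using inflate_parameter_le[OF *(3)] inflate_parameter_le[OF *(3)[symmetric]] D(2) de
        by (metis le_antisym less_trans zero_less_one)
      then have "d = e"
        using D[OF de(1)] D[OF de(2)] by (metis mult_left_cancel not_less_zero)
      with de(3) show False
        by blast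
    qed
  qed
  also have "\<dots> = (\<Sum>d\<in>D. card (tilings0 d b))"
    using D(2) by (intro sum.cong refl card_image inj_on_subset[OF inj_inflate]) force+
  finally show ?thesis
    by (simp add: D_def)
qed

text \<open>Except for the single-point tiling, \<open>1 \<notin> A\<close> means
  \<open>1 \<in> B\<close>; swapping the sets and deflating exchanges the roles of \<open>a\<close>
  and \<open>b\<close>.\<close>

lemma card_tilings0_rec:
  assumes "a > 0" "b > 0"
  shows "card (tilings0 a b) =
         of_bool (a = 1 \<and> b = 1) + (\<Sum>d | d dvd b \<and> d \<noteq> b. card (tilings0 d a))"
proof (cases "a * b = 1")
  case True
  then have [simp]: "a = 1" "b = 1"
    by auto
  have "{d. d dvd b \<and> d \<noteq> b} = {}"
    by auto
  moreover have "tilings0 a b = {({0}, {0})}"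
    using tilings_1_1 by (auto simp: tilings0_def)
  ultimately show ?thesis
    by simp
next
  case False
  moreover have "a * b > 0"
    using assms by simp
  ultimately have "b * a > 1"
    unfolding mult.commute[of b a] by linarith
  from tilings_one_in_fst[OF this] have
    "card (tilings0 a b) = card {(A, B) \<in> tilings b a. 1 \<in> A}"
    by (simp add: card_image)
  with False assms show ?thesis
    by (simp only: card_tilings_one_in_fst) auto
qed

text \<open>The inflation factors alternate between \<open>B\<close> and \<open>A\<close>, beginning
  with \<open>B\<close> at the finest level because \<open>1 \<notin> A\<close>. Hence
  \<open>i\<close> factors of \<open>a\<close> go with \<open>i\<close> or \<open>i + 1\<close>
  factors of \<open>b\<close>. The cut-off \<open>n\<close> stays fixed through the
  induction.\<close>

lemma card_tilings0_eq:
  assumes "a > 0" "b > 0" "a + b \<le> n"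
  shows "card (tilings0 a b) = (\<Sum>i\<le>n. ordered_factorisations i a *
           (ordered_factorisations i b + ordered_factorisations (Suc i) b))"
  using assms
proof (induction "a + b" arbitrary: a b rule: less_induct)
  case less
  let ?H = ordered_factorisations
  have "(\<Sum>d | d dvd b \<and> d \<noteq> b. card (tilings0 d a)) =
        (\<Sum>d | d dvd b \<and> d \<noteq> b. \<Sum>i\<le>n. ?H i d * (?H i a + ?H (Suc i) a))"
  proof (intro sum.cong refl)
    fix d assume "d \<in> {d. d dvd b \<and> d \<noteq> b}"
    then have "0 < d" "d < b"
      using less.prems dvd_imp_le[of d b] by (auto intro: Nat.gr0I)
    then show "card (tilings0 d a) = (\<Sum>i\<le>n. ?H i d * (?H i a + ?H (Suc i) a))"
      using less.prems by (intro less.hyps) auto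
  qed
  \<comment> \<open>Summing over the proper divisors of \<open>b\<close> adds one factor.\<close>
  also have "\<dots> = (\<Sum>i\<le>n. ?H (Suc i) b * (?H i a + ?H (Suc i) a))"
    by (subst sum.swap) (simp add: sum_distrib_right)
  finally have "card (tilings0 a b) = ?H 0 a * ?H 0 b + (\<Sum>i\<le>n. ?H (Suc i) a * ?H (Suc i) b) +
                  (\<Sum>i\<le>n. ?H i a * ?H (Suc i) b)"
    using card_tilings0_rec[OF less.prems(1,2)]
    by (simp add: sum.distrib distrib_left mult.commute of_bool_conj
        del: ordered_factorisations.simps(2))
  also have "?H 0 a * ?H 0 b + (\<Sum>i\<le>n. ?H (Suc i) a * ?H (Suc i) b) =
             (\<Sum>i\<le>Suc n. ?H i a * ?H i b)"
    by (rule sum.atMost_Suc_shift[symmetric])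
  \<comment> \<open>The top term vanishes because \<open>a \<le> Suc n\<close>.\<close>
  also have "\<dots> = (\<Sum>i\<le>n. ?H i a * ?H i b)"
    using less.prems ordered_factorisations_eq_0[of a "Suc n"]
    by (simp del: ordered_factorisations.simps)
  finally show ?case
    by (simp add: sum.distrib distrib_left del: ordered_factorisations.simps)
qed

section \<open>From labelings to tilings\<close>

text \<open>
  In a labeling, the extreme differences \<open>1\<close> and \<open>a * b\<close> force \<open>0\<close> to be the least element of
  \<open>S'\<close>, and \<open>S''\<close> to start right after the greatest element of \<open>S'\<close>.
\<close>
lemma alpha_labeling_count_eq_card_tilings:
  assumes "a > 0" "b > 0"
  shows "alpha_labeling_count a b = card (tilings a b)"
proof -
  define L where "L = {(S', S''). S' \<subseteq> {0..a * b} \<and> S'' \<subseteq> {0..a * b} \<and> card S' = a \<and> card S'' = b \<and>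
     {int y - int x | x y. x \<in> S' \<and> y \<in> S''} = {1..int (a * b)}}"
  \<comment> \<open>Chosen so that the difference of the images of \<open>y\<close> and
    \<open>x\<close> is \<open>x + y + 1\<close>, which carries \<open>{..<a * b}\<close> to
    \<open>{1..a * b}\<close>.\<close>
  define f :: "nat set \<times> nat set \<Rightarrow> nat set \<times> nat set" where
    "f = (\<lambda>(A, B). ((\<lambda>x. Max A - x) ` A, (\<lambda>y. y + Suc (Max A)) ` B))"
  define g :: "nat set \<times> nat set \<Rightarrow> nat set \<times> nat set" where
    "g = (\<lambda>(S, T). ((\<lambda>x. Max S - x) ` S, (\<lambda>y. y - Suc (Max S)) ` T))"
  have pos: "a * b > 0"
    using assms by simp
  \<comment> \<open>As \<open>0 \<in> A\<close>, reflection preserves the maximum, so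
    \<open>f\<close> and \<open>g\<close> shift by the same amount.\<close>
  have reflect: "Max ((\<lambda>x. Max A - x) ` A) = Max A" "(\<lambda>x. Max A - x) ` (\<lambda>x. Max A - x) ` A = A"
    "card ((\<lambda>x. Max A - x) ` A) = card A"
    if "finite A" "0 \<in> A" for A :: "nat set"
  proof -
    show "Max ((\<lambda>x. Max A - x) ` A) = Max A"
      using that by (intro Max_eqI) (auto intro!: image_eqI[of _ _ 0])
    show "(\<lambda>x. Max A - x) ` (\<lambda>x. Max A - x) ` A = A"
      using that by (force simp: image_image intro: image_cong[where g = id, simplified])
    show "card ((\<lambda>x. Max A - x) ` A) = card A"
      using that by (intro card_image inj_onI) (metis Max_ge diff_diff_cancel)
  qed
  have tD: "finite A" "finite B" "0 \<in> A" "0 \<in> B" "tiles A B (a * b)" "card A = a" "card B = b"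
    if "(A, B) \<in> tilings a b" for A B
    using that assms pos tiles_0[of A B "a * b"]
    by (auto simp: tilings_def intro: card_ge_0_finite)
  have LD: "finite S" "finite T" "card S = a" "card T = b" "0 \<in> S" "\<And>y. y \<in> T \<Longrightarrow> Suc (Max S) \<le> y"
    "\<And>x y. x \<in> S \<Longrightarrow> y \<in> T \<Longrightarrow> y - x \<le> a * b"
    "\<And>m. 0 < m \<Longrightarrow> m \<le> a * b \<Longrightarrow> \<exists>x\<in>S. \<exists>y\<in>T. y = x + m"
    if "(S, T) \<in> L" for S T
  proof -
    have *: "S \<subseteq> {0..a * b}" "T \<subseteq> {0..a * b}"
      "{int y - int x | x y. x \<in> S \<and> y \<in> T} = {1..int (a * b)}"
      using that by (auto simp: L_def)
    show card: "card S = a" "card T = b"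
      using that by (auto simp: L_def)
    then show fin: "finite S" "finite T"
      using assms by (auto intro: card_ge_0_finite)
    show ex: "\<exists>x\<in>S. \<exists>y\<in>T. y = x + m" if "0 < m" "m \<le> a * b" for m
    proof -
      have "int m \<in> {int y - int x | x y. x \<in> S \<and> y \<in> T}"
        unfolding *(3) using that by (simp flip: of_nat_mult)
      then obtain x y where "int m = int y - int x" "x \<in> S" "y \<in> T"
        by blast
      moreover from this have "y = x + m"
        by linarith
      ultimately show ?thesis
        by blast
    qed
    have diff: "x < y \<and> y - x \<le> a * b" if "x \<in> S" "y \<in> T" for x y
    proof -
      have "int y - int x \<in> {1..int (a * b)}"
        unfolding *(3)[symmetric] using that by blast
      then show ?thesis
        by (auto simp flip: of_nat_mult)
    qed
    then show "y - x \<le> a * b" if "x \<in> S" "y \<in> T" for x y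
      using that by blast
    \<comment> \<open>The difference \<open>a * b\<close> inside \<open>{0..a * b}\<close> forces
      \<open>x = 0\<close> and \<open>y = a * b\<close>.\<close>
    show "0 \<in> S"
      using ex[of "a * b"] pos *(2) by fastforce
    then show "Suc (Max S) \<le> y" if "y \<in> T" for y
      using diff[OF _ that] fin by (auto simp: Suc_le_eq intro!: Max_in)
  qed
  have "bij_betw f (tilings a b) L"
  proof (rule bij_betw_byWitness[where f' = g])
    show "\<forall>p\<in>tilings a b. g (f p) = p"
      using tD by (auto simp: f_def g_def reflect image_image)
    show "\<forall>p\<in>L. f (g p) = p"
    proof clarify
      fix S T assume "(S, T) \<in> L"
      note LD = LD[OF this]
      have "(\<lambda>y. y - Suc (Max S) + Suc (Max S)) ` T = (\<lambda>y. y) ` T"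
        using LD(6) by (intro image_cong refl le_add_diff_inverse2)
      then show "f (g (S, T)) = (S, T)"
        using LD(1,5) by (simp add: f_def g_def reflect image_image[where A = T])
    qed
    show "f ` tilings a b \<subseteq> L"
    proof (rule image_subsetI, clarify)
      fix A B assume "(A, B) \<in> tilings a b"
      note tD = tD[OF this]
      have "Max A \<in> A"
        using tD by (intro Max_in) auto
      have "{int y - int x | x y. x \<in> (\<lambda>x. Max A - x) ` A \<and> y \<in> (\<lambda>y. y + Suc (Max A)) ` B} =
            {int (x + y) + 1 | x y. x \<in> A \<and> y \<in> B}" (is "?D = _")
      proof -
        have *: "int (y + Suc (Max A)) - int (Max A - x) = int (x + y) + 1" if "x \<in> A" for x y
          using Max_ge[OF tD(1) that] by simp
        show ?thesis
        proof (intro equalityI subsetI)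
          fix z assume "z \<in> ?D"
          then obtain x y where "x \<in> A" "y \<in> B" "z = int (y + Suc (Max A)) - int (Max A - x)"
            by blast
          moreover from this have "z = int (x + y) + 1"
            by (simp only: *)
          ultimately show "z \<in> {int (x + y) + 1 | x y. x \<in> A \<and> y \<in> B}"
            by blast
        next
          fix z assume "z \<in> {int (x + y) + 1 | x y. x \<in> A \<and> y \<in> B}"
          then obtain x y where xy: "x \<in> A" "y \<in> B" "z = int (x + y) + 1"
            by blast
          then have "z = int (y + Suc (Max A)) - int (Max A - x)"
            by (simp only: *)
          with xy(1,2) show "z \<in> ?D"
            by blast
        qed
      qed
      also have "\<dots> = {1..int (a * b)}"
      proof (intro equalityI subsetI)
        fix z assume "z \<in> {int (x + y) + 1 | x y. x \<in> A \<and> y \<in> B}"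
        then obtain x y where "x \<in> A" "y \<in> B" "z = int (x + y) + 1"
          by blast
        with tiles_less[OF tD(5), of x y] show "z \<in> {1..int (a * b)}"
          unfolding atLeastAtMost_iff by linarith
      next
        fix z assume "z \<in> {1..int (a * b)}"
        then have z: "nat (z - 1) < a * b" "z = int (nat (z - 1)) + 1"
          unfolding atLeastAtMost_iff by linarith+
        obtain x y where "x \<in> A" "y \<in> B" "nat (z - 1) = x + y"
          using tiles_cover[OF tD(5) z(1)] .
        with z(2) have "x \<in> A" "y \<in> B" "z = int (x + y) + 1"
          by simp_all
        then show "z \<in> {int (x + y) + 1 | x y. x \<in> A \<and> y \<in> B}"
          by blast
      qed
      finally have "?D = {1..int (a * b)}" .
      moreover have "(\<lambda>x. Max A - x) ` A \<subseteq> {0..a * b}" "(\<lambda>y. y + Suc (Max A)) ` B \<subseteq> {0..a * b}"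
        using tiles_less[OF tD(5) \<open>Max A \<in> A\<close>] tD(4)
          tiles_less[OF tD(5) \<open>Max A \<in> A\<close> tD(4)]
        by (auto simp: Suc_le_eq add.commute)
      moreover have "card ((\<lambda>x. Max A - x) ` A) = a" "card ((\<lambda>y. y + Suc (Max A)) ` B) = b"
        using tD by (auto simp: reflect card_image inj_on_def)
      ultimately show "f (A, B) \<in> L"
        by (simp add: f_def L_def)
    qed
    show "g ` L \<subseteq> tilings a b"
    proof (rule image_subsetI, clarify)
      fix S T assume "(S, T) \<in> L"
      note LD = LD[OF this]
      have cS: "card ((\<lambda>x. Max S - x) ` S) = a"
        using LD by (simp add: reflect)
      have cT: "card ((\<lambda>y. y - Suc (Max S)) ` T) = b"
        using LD(4,6) by (subst card_image) (auto intro!: inj_onI dest!: LD(6))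
      have "tiles ((\<lambda>x. Max S - x) ` S) ((\<lambda>y. y - Suc (Max S)) ` T) (a * b)"
      proof (rule tilesI)
        fix u v assume "u \<in> (\<lambda>x. Max S - x) ` S" "v \<in> (\<lambda>y. y - Suc (Max S)) ` T"
        then obtain x y where xy: "x \<in> S" "y \<in> T" "u = Max S - x" "v = y - Suc (Max S)"
          by blast
        then show "u + v < a * b"
          using LD(6)[OF xy(2)] LD(7)[OF xy(1,2)] Max_ge[OF LD(1) xy(1)] by simp
      next
        fix m assume "m < a * b"
        then obtain x y where xy: "x \<in> S" "y \<in> T" "y = x + Suc m"
          using LD(8)[of "Suc m"] by auto
        then have "m = (Max S - x) + (y - Suc (Max S))"
          using LD(6)[OF xy(2)] Max_ge[OF LD(1) xy(1)] by simp
        with xy show "\<exists>u\<in>(\<lambda>x. Max S - x) ` S. \<exists>v\<in>(\<lambda>y. y - Suc (Max S)) ` T. m = u + v"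
          by blast
      qed (use LD cS cT in auto)
      then show "g (S, T) \<in> tilings a b"
        using cS cT by (simp add: g_def tilings_def)
    qed
  qed
  then have "card (tilings a b) = card L"
    by (rule bij_betw_same_card)
  then show ?thesis
    by (simp add: alpha_labeling_count_def L_def)
qed

theorem theorem2:
  fixes a b :: nat
  assumes "a > 0" and "b > 0"
  shows "(\<not> (a = 1 \<and> b = 1) \<longrightarrow>
            real (alpha_labeling_count a b) =
              (shift_poly (factorisation_poly a) \<bigcirc> factorisation_poly b) +
              (factorisation_poly a \<bigcirc> shift_poly (factorisation_poly b)))
         \<and> alpha_labeling_count 1 1 = 1"
proof (intro conjI impI)
  show "alpha_labeling_count 1 1 = 1"
    by (simp only: alpha_labeling_count_eq_card_tilings zero_less_one tilings_1_1) simp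
next
  assume "\<not> (a = 1 \<and> b = 1)"
  then have "a * b \<noteq> 1" "a * b \<noteq> 0"
    using assms by auto
  then have "a * b > 1"
    by linarith
  \<comment> \<open>Large enough for the tiling formula (\<open>a + b\<close>) and, through the
    degree of the polynomial belonging to \<open>a\<close>, for truncating both series.\<close>
  define n where "n = a + b + degree (factorisation_poly a) + degree (shift_poly (factorisation_poly a))"
  have "shift_poly (factorisation_poly a) \<bigcirc> factorisation_poly b = real (card (tilings0 a b))"
    using assms
    by (subst newton_circ_eq_finite_sum[of _ _ n])
       (simp_all add: n_def card_tilings0_eq[of a b n] binomial_coeff_shift_factorisation_poly
          binomial_coeff_factorisation_poly del: ordered_factorisations.simps)
  moreover have "factorisation_poly a \<bigcirc> shift_poly (factorisation_poly b) = real (card (tilings0 b a))"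
    using assms
    by (subst newton_circ_eq_finite_sum[of _ _ n])
       (simp_all add: n_def card_tilings0_eq[of b a n] binomial_coeff_shift_factorisation_poly
          binomial_coeff_factorisation_poly mult.commute del: ordered_factorisations.simps)
  ultimately show "real (alpha_labeling_count a b) =
              (shift_poly (factorisation_poly a) \<bigcirc> factorisation_poly b) +
              (factorisation_poly a \<bigcirc> shift_poly (factorisation_poly b))"
    by (simp add: alpha_labeling_count_eq_card_tilings[OF assms] card_tilings[OF \<open>a * b > 1\<close>])
qed

end
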